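(* Let $F,\phi:\mathcal X\to\mathbb R\cup\{+\infty\}$ be proper lower semicontinuous functions such that $\inf_{x\in\mathcal X}(F+\phi)(x)>-\infty$; $F$ is locally Lipschitz continuous at every point of $\operatorname{int}(\operatorname{dom}F)$; $\operatorname{dom}F$ is convex with $\operatorname{dom}\phi\subset\operatorname{int}(\operatorname{dom}F)$; and $\phi$ is prox-bounded with threshold $\gamma_\phi\in(0,+\infty]$. Assume moreover that $F$ is differentiable over $\operatorname{int}(\operatorname{dom}F)$ and that $\nabla F:\operatorname{int}(\operatorname{dom}F)\to\mathcal X$ is locally Lipschitz continuous at every point of $\operatorname{int}(\operatorname{dom}F)$. Let $(x_n)_{n=1}^\infty\subset\operatorname{dom}\phi$ be generated by the proximal gradient method, i.e., $$x_{n+1}\in\operatorname{prox}_{\gamma_n\phi}\big(x_n-\gamma_n\nabla F(x_n)\big)\qquad(n\in\mathbb N)$$ with stepsizes $\gamma_n>0$. Let $\bar x\in\mathcal X$ be a cluster point of $(x_n)_{n=1}^\infty$. If there is an infinite index set $\mathcal N\subset\mathbb N$ satisfying $\lim_{\mathcal N\ni n\to\infty}x_n=\bar x$ for which all of the following conditions hold: $\bar x\in\operatorname{dom}\phi$; $\lim_{\mathcal N\ni n\to\infty}\|x_{n+1}-x_n\|=0$; and $(\gamma_n)_{n\in\mathcal N}\subset[\gamma_{\rm low},\gamma_{\rm up}]$ for some $\gamma_{\rm low},\gamma_{\rm up}\in(0,\gamma_\phi)$; then $\bar x$ is a proximal stationary point of $F+\phi$.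
   Context: $\mathcal X$ is a (finite-dimensional real) Euclidean space with inner product $\langle\cdot,\cdot\rangle$ and norm $\|\cdot\|$; $B(\bar x,\delta)$ is the open ball; $\operatorname{dom}\psi=\{x:\psi(x)<+\infty\}$; proper means $\operatorname{dom}\psi\neq\emptyset$. A function (or mapping) is locally Lipschitz continuous at $\bar x$ if it is Lipschitz continuous on some open neighborhood of $\bar x$. $\phi$ is prox-bounded with threshold $\gamma_\phi\in(0,+\infty]$ if $\phi+\frac1{2\gamma}\|\cdot\|^2$ is bounded below for all $\gamma\in(0,\gamma_\phi)$. For $\gamma>0$, $\operatorname{prox}_{\gamma\phi}(\bar x)=\operatorname{argmin}_{x\in\mathcal X}\big(\phi(x)+\frac1{2\gamma}\|x-\bar x\|^2\big)$ (a set). For $\psi:\mathcal X\to\mathbb R\cup\{+\infty\}$ and $\bar x\in\operatorname{dom}\psi$, the proximal subdifferential $\partial_{\rm P}\psi(\bar x)$ is the set of all $v\in\mathcal X$ for which there are $\gamma,\delta>0$ with $\psi(x)\ge\psi(\bar x)+\langle v,x-\bar x\rangle-\frac1{2\gamma}\|x-\bar x\|^2$ for all $x\in B(\bar x,\delta)$. A point $x^\star\in\operatorname{dom}\phi$ is a proximal stationary point of $F+\phi$ if $0\in\partial_{\rm P}(F+\phi)(x^\star)$. *)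

theory Defs
  imports "HOL-Analysis.Analysis"
begin

(* Functions into the reals extended by plus infinity are modelled as ereal-valued functions that
   never take the value minus infinity; the latter condition is ext_valued. *)

definition ext_valued :: "('a \<Rightarrow> ereal) \<Rightarrow> bool" where
  "ext_valued \<psi> \<longleftrightarrow> (\<forall>x. \<psi> x \<noteq> -\<infinity>)"

definition effdom :: "('a \<Rightarrow> ereal) \<Rightarrow> 'a set" where
  "effdom \<psi> = {x. \<psi> x < \<infinity>}"

definition proper :: "('a \<Rightarrow> ereal) \<Rightarrow> bool" where
  "proper \<psi> \<longleftrightarrow> effdom \<psi> \<noteq> {}"

definition lsc :: "('a::topological_space \<Rightarrow> ereal) \<Rightarrow> bool" where
  "lsc \<psi> \<longleftrightarrow> (\<forall>x. \<psi> x \<le> Liminf (at x) \<psi>)"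

(* S is the set on which g is meaningful (for an extended-valued function, real_of_ereal
   sends infinity to 0); hence the Lipschitz neighborhood must stay inside S. *)

definition locally_lipschitz_at ::
    "'a::metric_space set \<Rightarrow> ('a \<Rightarrow> 'b::metric_space) \<Rightarrow> 'a \<Rightarrow> bool" where
  "locally_lipschitz_at S g x \<longleftrightarrow>
     (\<exists>U L. open U \<and> x \<in> U \<and> U \<subseteq> S \<and> L-lipschitz_on U g)"

definition grad :: "('a::euclidean_space \<Rightarrow> ereal) \<Rightarrow> 'a \<Rightarrow> 'a" where
  "grad F x = (THE D. GDERIV (\<lambda>y. real_of_ereal (F y)) x :> D)"

definition prox_bounded_with_threshold ::
    "('a::euclidean_space \<Rightarrow> ereal) \<Rightarrow> ereal \<Rightarrow> bool" where
  "prox_bounded_with_threshold \<phi> \<gamma>\<phi> \<longleftrightarrow> 0 < \<gamma>\<phi> \<and>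
     (\<forall>\<gamma>::real. 0 < \<gamma> \<and> ereal \<gamma> < \<gamma>\<phi> \<longrightarrow>
        (\<exists>m::real. \<forall>x. ereal m \<le> \<phi> x + ereal (1 / (2 * \<gamma>) * (norm x)\<^sup>2)))"

definition prox :: "real \<Rightarrow> ('a::euclidean_space \<Rightarrow> ereal) \<Rightarrow> 'a \<Rightarrow> 'a set" where
  "prox \<gamma> \<phi> z =
     {x. is_arg_min (\<lambda>y. \<phi> y + ereal (1 / (2 * \<gamma>) * (norm (y - z))\<^sup>2)) (\<lambda>_. True) x}"

(* Empty outside the effective domain. *)

definition proximal_subdifferential ::
    "('a::euclidean_space \<Rightarrow> ereal) \<Rightarrow> 'a \<Rightarrow> 'a set" where
  "proximal_subdifferential \<psi> z =
     {v. z \<in> effdom \<psi> \<and>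
        (\<exists>\<gamma>>0. \<exists>\<delta>>0. \<forall>x \<in> ball z \<delta>.
           \<psi> x \<ge> \<psi> z + ereal (v \<bullet> (x - z) - 1 / (2 * \<gamma>) * (norm (x - z))\<^sup>2))}"

definition proximal_stationary ::
    "('a::euclidean_space \<Rightarrow> ereal) \<Rightarrow> ('a \<Rightarrow> ereal) \<Rightarrow> 'a \<Rightarrow> bool" where
  "proximal_stationary F \<phi> z \<longleftrightarrow>
     z \<in> effdom \<phi> \<and> 0 \<in> proximal_subdifferential (\<lambda>x. F x + \<phi> x) z"

end

theory Submission
  imports Defs
begin

text \<open>Comparing the prox minimizer with an arbitrary competitor \<open>y\<close> and expanding the squares gives
  \<open>\<phi> (x (n+1)) + \<nabla>F (x n) \<bullet> (x (n+1) - x n)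
    \<le> \<phi> y + \<nabla>F (x n) \<bullet> (y - x n) + |y - x n|\<^sup>2 / (2 * \<gamma>low)\<close>.
  Along \<open>N\<close> this passes to the limit, by lower semicontinuity of \<open>\<phi>\<close> and continuity of \<open>\<nabla>F\<close>, so
  \<open>- \<nabla>F xbar\<close> is a (global) proximal subgradient of \<open>\<phi>\<close> at \<open>xbar\<close>. Since \<open>\<nabla>F\<close> is Lipschitz near
  \<open>xbar\<close>, \<open>\<nabla>F xbar\<close> is a proximal subgradient of \<open>F\<close> there, and the two inequalities add up.\<close>

lemma ext_valued_cases:
  assumes "ext_valued \<psi>" "y \<in> effdom \<psi>"
  obtains r where "\<psi> y = ereal r"
  using assms unfolding ext_valued_def effdom_def by (cases "\<psi> y") auto

text \<open>\<open>grad\<close> is a definite description, so it carries information only once a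
  gradient is known to exist and be unique. Existence is the Riesz representation of the derivative;
  uniqueness is inherited from that of the Frechet derivative.\<close>

lemma GDERIV_grad:
  fixes F :: "'a::euclidean_space \<Rightarrow> ereal"
  assumes "(\<lambda>z. real_of_ereal (F z)) differentiable (at y)"
  shows "GDERIV (\<lambda>z. real_of_ereal (F z)) y :> grad F y"
proof -
  let ?f = "\<lambda>z. real_of_ereal (F z)"
  obtain f' where f': "(?f has_derivative f') (at y)"
    using assms unfolding differentiable_def by blast
  then interpret bounded_linear f' by (rule has_derivative_bounded_linear)
  \<comment> \<open>The Riesz vector of \<open>f'\<close>: its coordinates are the partial
    derivatives.\<close>
  define D where "D = (\<Sum>b\<in>Basis. f' b *\<^sub>R b)"
  have "f' h = h \<bullet> D" for h
  proof -
    have "f' h = f' (\<Sum>b\<in>Basis. (h \<bullet> b) *\<^sub>R b)" by (simp add: euclidean_representation)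
    also have "\<dots> = h \<bullet> D" by (simp add: sum scaleR D_def inner_sum_right mult.commute)
    finally show ?thesis .
  qed
  then have "f' = (\<lambda>h. h \<bullet> D)" by (rule ext)
  with f' have D: "GDERIV ?f y :> D" by (simp add: gderiv_def)
  have unique: "E = D" if "GDERIV ?f y :> E" for E
  proof -
    have "(\<lambda>h. h \<bullet> E) = (\<lambda>h. h \<bullet> D)"
      using that D unfolding gderiv_def by (rule has_derivative_unique)
    then have "h \<bullet> E = h \<bullet> D" for h by (rule fun_cong)
    then show ?thesis using vector_eq_ldot[of E D] by blast
  qed
  have "grad F y = D"
    unfolding grad_def by (rule the_equality[where P = "\<lambda>E. GDERIV ?f y :> E"]) (fact D, fact unique)
  with D show ?thesis by simp
qed

text \<open>Mean value estimate for \<open>f\<close> minus its linear part at \<open>a\<close>: by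
  Cauchy-Schwarz, the derivative of this difference on the segment has operator norm at most
  \<open>L * norm (b - a)\<close>. Integration would give the sharper constant L/2, but any constant
  serves for a proximal subgradient.\<close>

lemma gradient_lipschitz_linearization:
  fixes f :: "'a::euclidean_space \<Rightarrow> real"
  assumes der: "\<And>u. u \<in> closed_segment a b \<Longrightarrow> GDERIV f u :> G u"
    and lip: "L-lipschitz_on (closed_segment a b) G"
  shows "\<bar>f b - f a - G a \<bullet> (b - a)\<bar> \<le> L * (norm (b - a))\<^sup>2"
proof -
  have "norm (f b - f a - (b - a) \<bullet> G a) \<le> norm (b - a) * (L * norm (b - a))"
  proof (rule differentiable_bound_linearization
      [where S = "closed_segment a b" and f' = "\<lambda>u h. h \<bullet> G u"])
    show "a + t *\<^sub>R (b - a) \<in> closed_segment a b" if "t \<in> {0..1}" for t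
      using that by (auto simp: closed_segment_def algebra_simps intro!: exI[of _ t])
    show "(f has_derivative (\<lambda>h. h \<bullet> G u)) (at u within closed_segment a b)"
      if "u \<in> closed_segment a b" for u
      using der[OF that] unfolding gderiv_def by (rule has_derivative_at_withinI)
    show "onorm ((\<lambda>h. h \<bullet> G u) - (\<lambda>h. h \<bullet> G a)) \<le> L * norm (b - a)"
      if u: "u \<in> closed_segment a b" for u
      unfolding fun_diff_def
    proof (rule onorm_bound)
      have L: "0 \<le> L" using lip by (rule lipschitz_on_nonneg)
      then show "0 \<le> L * norm (b - a)" by simp
      fix h
      have "norm (G u - G a) \<le> L * norm (u - a)"
        using lipschitz_onD[OF lip u ends_in_segment(1)] by (simp add: dist_norm)
      also have "\<dots> \<le> L * norm (b - a)"
        using segment_bound(1)[OF u] L by (simp add: mult_left_mono)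
      finally have *: "norm (G u - G a) \<le> L * norm (b - a)" .
      have "norm (h \<bullet> (G u - G a)) \<le> norm h * norm (G u - G a)"
        by (simp add: Cauchy_Schwarz_ineq2)
      also have "\<dots> \<le> norm h * (L * norm (b - a))" by (intro mult_left_mono *) simp
      finally show "norm (h \<bullet> G u - h \<bullet> G a) \<le> L * norm (b - a) * norm h"
        by (simp add: inner_diff_right mult.commute)
    qed
  qed simp
  then show ?thesis by (simp add: inner_commute power2_eq_square mult_ac)
qed

lemma grad_proximal_lower_bound:
  fixes F :: "'a::euclidean_space \<Rightarrow> ereal"
  assumes diff: "\<forall>y \<in> interior (effdom F). (\<lambda>z. real_of_ereal (F z)) differentiable (at y)"
    and lip: "locally_lipschitz_at (interior (effdom F)) (grad F) a"
  obtains L \<delta> where "0 \<le> L" "0 < \<delta>" "ball a \<delta> \<subseteq> effdom F"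
    "\<forall>y\<in>ball a \<delta>. real_of_ereal (F a) + grad F a \<bullet> (y - a) - L * (norm (y - a))\<^sup>2
       \<le> real_of_ereal (F y)"
proof -
  obtain U L where U: "open U" "a \<in> U" "U \<subseteq> interior (effdom F)" "L-lipschitz_on U (grad F)"
    using lip unfolding locally_lipschitz_at_def by blast
  then obtain \<delta> where \<delta>: "0 < \<delta>" "ball a \<delta> \<subseteq> U" using open_contains_ball by blast
  have "real_of_ereal (F a) + grad F a \<bullet> (y - a) - L * (norm (y - a))\<^sup>2 \<le> real_of_ereal (F y)"
    if "y \<in> ball a \<delta>" for y
  proof -
    \<comment> \<open>Balls are convex, so the whole segment stays where the gradient exists and is
      Lipschitz.\<close>
    have seg: "closed_segment a y \<subseteq> U"
      using \<delta> by (intro subset_trans[OF closed_segment_subset[OF _ that convex_ball]]) auto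
    have "\<bar>real_of_ereal (F y) - real_of_ereal (F a) - grad F a \<bullet> (y - a)\<bar>
        \<le> L * (norm (y - a))\<^sup>2"
    proof (rule gradient_lipschitz_linearization)
      show "GDERIV (\<lambda>z. real_of_ereal (F z)) u :> grad F u" if "u \<in> closed_segment a y" for u
      proof -
        have "u \<in> interior (effdom F)" using that seg U(3) by blast
        then show ?thesis using diff by (intro GDERIV_grad) blast
      qed
      show "L-lipschitz_on (closed_segment a y) (grad F)"
        using U(4) seg by (rule lipschitz_on_subset)
    qed
    then show ?thesis by linarith
  qed
  moreover have "ball a \<delta> \<subseteq> effdom F" using \<delta>(2) U(3) interior_subset by blast
  ultimately show ?thesis by (intro that[OF lipschitz_on_nonneg[OF U(4)] \<delta>(1)]) blast+
qed

lemma continuous_locally_lipschitz_at: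
  assumes "locally_lipschitz_at S g a"
  shows "isCont g a"
proof -
  obtain U L where "open U" "a \<in> U" "L-lipschitz_on U g"
    using assms unfolding locally_lipschitz_at_def by blast
  then show ?thesis
    using lipschitz_on_continuous_on[of L U g] continuous_on_eq_continuous_at[of U g] by blast
qed

text \<open>\<open>lsc\<close> speaks of punctured neighborhoods only. The assumption
  \<open>c < \<psi> a\<close> adds the point \<open>a\<close> itself, so \<open>u\<close> may take
  the value \<open>a\<close>.\<close>

lemma lsc_eventually_greater:
  assumes "lsc \<psi>" "(u \<longlongrightarrow> a) G" "c < \<psi> a"
  shows "eventually (\<lambda>n. c < \<psi> (u n)) G"
proof -
  have "eventually (\<lambda>y. c < \<psi> y) (at a)"
    using assms unfolding lsc_def le_Liminf_iff by blast
  then have "eventually (\<lambda>y. c < \<psi> y) (nhds a)"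
    using assms(3) by (simp add: eventually_nhds_conv_at)
  then show ?thesis using assms(2) by (rule eventually_compose_filterlim)
qed

text \<open>The square of \<open>norm g\<close> occurs on both sides and cancels, and the quadratic
  term at \<open>p\<close> is nonnegative and is dropped. Replacing \<gamma> by a lower bound
  \<open>c\<close> makes the estimate uniform over varying stepsizes.\<close>

lemma prox_gradient_step_le:
  fixes \<phi> :: "'a::euclidean_space \<Rightarrow> ereal"
  assumes "p \<in> prox \<gamma> \<phi> (z - \<gamma> *\<^sub>R g)" "\<phi> p = ereal P" "\<phi> y = ereal Y" "0 < c" "c \<le> \<gamma>"
  shows "P + g \<bullet> (p - z) \<le> Y + g \<bullet> (y - z) + (norm (y - z))\<^sup>2 / (2 * c)"
proof -
  have \<gamma>: "0 < \<gamma>" using assms by linarith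
  have exp: "1 / (2 * \<gamma>) * (norm (w - (z - \<gamma> *\<^sub>R g)))\<^sup>2
      = (norm (w - z))\<^sup>2 / (2 * \<gamma>) + g \<bullet> (w - z) + \<gamma> / 2 * (norm g)\<^sup>2" for w
  proof -
    have "w - (z - \<gamma> *\<^sub>R g) = (w - z) + \<gamma> *\<^sub>R g" by simp
    then have "(norm (w - (z - \<gamma> *\<^sub>R g)))\<^sup>2
        = (norm (w - z))\<^sup>2 + 2 * \<gamma> * (g \<bullet> (w - z)) + \<gamma>\<^sup>2 * (norm g)\<^sup>2"
      by (simp only: power2_norm_eq_inner)
        (simp add: inner_add_left inner_add_right inner_commute power2_eq_square)
    then show ?thesis using \<gamma> by (simp add: field_simps power2_eq_square)
  qed
  have "\<not> \<phi> y + ereal (1 / (2 * \<gamma>) * (norm (y - (z - \<gamma> *\<^sub>R g)))\<^sup>2)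
      < \<phi> p + ereal (1 / (2 * \<gamma>) * (norm (p - (z - \<gamma> *\<^sub>R g)))\<^sup>2)"
    using assms(1) unfolding prox_def is_arg_min_def by blast
  then have "P + g \<bullet> (p - z) + (norm (p - z))\<^sup>2 / (2 * \<gamma>)
      \<le> Y + g \<bullet> (y - z) + (norm (y - z))\<^sup>2 / (2 * \<gamma>)"
    unfolding exp assms(2,3) by simp
  moreover have "0 \<le> (norm (p - z))\<^sup>2 / (2 * \<gamma>)" using \<gamma> by simp
  moreover have "(norm (y - z))\<^sup>2 / (2 * \<gamma>) \<le> (norm (y - z))\<^sup>2 / (2 * c)"
    using assms(4,5) by (intro divide_left_mono) auto
  ultimately show ?thesis by linarith
qed

lemma prox_gradient_limit:
  fixes \<phi> :: "'a::euclidean_space \<Rightarrow> ereal"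
  assumes "ext_valued \<phi>" "lsc \<phi>" "G \<noteq> bot"
    and z: "(z \<longlongrightarrow> a) G" and p: "(p \<longlongrightarrow> a) G" and g: "(g \<longlongrightarrow> d) G"
    and step: "eventually (\<lambda>n. p n \<in> effdom \<phi> \<and> p n \<in> prox (\<gamma> n) \<phi> (z n - \<gamma> n *\<^sub>R g n)
      \<and> c \<le> \<gamma> n) G"
    and "0 < c"
  shows "\<phi> a \<le> \<phi> y + ereal (d \<bullet> (y - a) + (norm (y - a))\<^sup>2 / (2 * c))"
proof (cases "\<phi> y = \<infinity>")
  case False
  then obtain Y where Y: "\<phi> y = ereal Y"
    using assms(1) unfolding ext_valued_def by (cases "\<phi> y") auto
  \<comment> \<open>Testing with reals \<open>r\<close> below \<open>\<phi> a\<close> reduces lower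
    semicontinuity to limits of real sequences, without assuming \<open>\<phi> a\<close>
    finite.\<close>
  have bound: "r \<le> Y + d \<bullet> (y - a) + (norm (y - a))\<^sup>2 / (2 * c)" if "ereal r < \<phi> a" for r
  proof (rule tendsto_le[OF \<open>G \<noteq> bot\<close>])
    show "((\<lambda>n. Y + g n \<bullet> (y - z n) + (norm (y - z n))\<^sup>2 / (2 * c))
        \<longlongrightarrow> Y + d \<bullet> (y - a) + (norm (y - a))\<^sup>2 / (2 * c)) G"
      using \<open>0 < c\<close> by (intro tendsto_intros z g) simp
    have "((\<lambda>n. r + g n \<bullet> (p n - z n)) \<longlongrightarrow> r + d \<bullet> (a - a)) G"
      by (intro tendsto_intros z g p)
    then show "((\<lambda>n. r + g n \<bullet> (p n - z n)) \<longlongrightarrow> r) G" by simp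
    show "\<forall>\<^sub>F n in G. r + g n \<bullet> (p n - z n)
        \<le> Y + g n \<bullet> (y - z n) + (norm (y - z n))\<^sup>2 / (2 * c)"
      using step lsc_eventually_greater[OF assms(2) p that]
    proof eventually_elim
      case (elim n)
      then obtain P where P: "\<phi> (p n) = ereal P" using ext_valued_cases[OF assms(1)] by blast
      show ?case using prox_gradient_step_le[OF _ P Y \<open>0 < c\<close>, of "\<gamma> n" "z n" "g n"] elim by (simp add: P)
    qed
  qed
  \<comment> \<open>Otherwise a real would lie strictly between the bound and
    \<open>\<phi> a\<close>, against \<open>bound\<close>.\<close>
  have "\<phi> a \<le> ereal (Y + d \<bullet> (y - a) + (norm (y - a))\<^sup>2 / (2 * c))"
  proof (rule ccontr)
    assume "\<not> ?thesis"
    then have "ereal (Y + d \<bullet> (y - a) + (norm (y - a))\<^sup>2 / (2 * c)) < \<phi> a" by (rule not_le_imp_less)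
    from ereal_dense2[OF this] obtain r
      where "ereal (Y + d \<bullet> (y - a) + (norm (y - a))\<^sup>2 / (2 * c)) < ereal r" "ereal r < \<phi> a"
      by auto
    with bound[of r] show False by simp
  qed
  then show ?thesis by (simp add: Y add.assoc)
qed simp

theorem corollary4p2:
  fixes F \<phi> :: "'a::euclidean_space \<Rightarrow> ereal"
    and \<gamma>\<phi> :: ereal
    and x :: "nat \<Rightarrow> 'a" and \<gamma> :: "nat \<Rightarrow> real"
    and xbar :: 'a
    and N :: "nat set" and \<gamma>low \<gamma>up :: real
  assumes "ext_valued F" "proper F" "lsc F"
    and "ext_valued \<phi>" "proper \<phi>" "lsc \<phi>"
    and "(INF y. F y + \<phi> y) > -\<infinity>"
    and "\<forall>y \<in> interior (effdom F).
           locally_lipschitz_at (effdom F) (\<lambda>z. real_of_ereal (F z)) y"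
    and "convex (effdom F)"
    and "effdom \<phi> \<subseteq> interior (effdom F)"
    and "prox_bounded_with_threshold \<phi> \<gamma>\<phi>"
    and "\<forall>y \<in> interior (effdom F). (\<lambda>z. real_of_ereal (F z)) differentiable (at y)"
    and "\<forall>y \<in> interior (effdom F). locally_lipschitz_at (interior (effdom F)) (grad F) y"
    and "\<forall>n\<ge>1. x n \<in> effdom \<phi>"
    and "\<forall>n\<ge>1. \<gamma> n > 0"
    and "\<forall>n\<ge>1. x (Suc n) \<in> prox (\<gamma> n) \<phi> (x n - \<gamma> n *\<^sub>R grad F (x n))"
    and "\<exists>r. strict_mono r \<and> (x \<circ> r) \<longlonglongrightarrow> xbar"
    and "infinite N" "N \<subseteq> {1..}"
    and "(x \<longlongrightarrow> xbar) (inf sequentially (principal N))"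
    and "xbar \<in> effdom \<phi>"
    and "((\<lambda>n. norm (x (Suc n) - x n)) \<longlongrightarrow> 0) (inf sequentially (principal N))"
    and "0 < \<gamma>low" "ereal \<gamma>low < \<gamma>\<phi>" "0 < \<gamma>up" "ereal \<gamma>up < \<gamma>\<phi>"
    and "\<forall>n \<in> N. \<gamma> n \<in> {\<gamma>low..\<gamma>up}"
  shows "proximal_stationary F \<phi> xbar"
proof -
  let ?G = "inf sequentially (principal N)"
  define d where "d = grad F xbar"
  have int: "xbar \<in> interior (effdom F)" using assms(10,21) by blast
  have "\<forall>n. \<exists>m\<ge>n. m \<in> N"
    using \<open>infinite N\<close> by (simp add: infinite_nat_iff_unbounded_le)
  then have G: "?G \<noteq> bot"
    by (auto simp: trivial_limit_def eventually_inf_principal eventually_sequentially)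
  have N: "eventually (\<lambda>n. n \<in> N) ?G" by (simp add: eventually_inf_principal)
  \<comment> \<open>The successor index need not lie in \<open>N\<close>; vanishing step lengths
    still force the shifted iterates to converge to \<open>xbar\<close> along
    \<open>N\<close>.\<close>
  have "((\<lambda>n. x (Suc n) - x n) \<longlongrightarrow> 0) ?G" using assms(22) by (rule tendsto_norm_zero_cancel)
  then have "((\<lambda>n. (x (Suc n) - x n) + x n) \<longlongrightarrow> 0 + xbar) ?G" using assms(20) by (rule tendsto_add)
  then have p: "((\<lambda>n. x (Suc n)) \<longlongrightarrow> xbar) ?G" by simp
  have lip: "locally_lipschitz_at (interior (effdom F)) (grad F) xbar" using assms(13) int by blast
  have g: "((\<lambda>n. grad F (x n)) \<longlongrightarrow> d) ?G"
    unfolding d_def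
    using continuous_locally_lipschitz_at[OF lip] assms(20) by (rule isCont_tendsto_compose)
  have step: "eventually (\<lambda>n. x (Suc n) \<in> effdom \<phi>
      \<and> x (Suc n) \<in> prox (\<gamma> n) \<phi> (x n - \<gamma> n *\<^sub>R grad F (x n)) \<and> \<gamma>low \<le> \<gamma> n) ?G"
    \<comment> \<open>The recursion is given from index 1 on, which
      \<open>N \<subseteq> {1..}\<close> guarantees.\<close>
    using N by eventually_elim (use assms(14,16,19,27) in auto)
  have \<phi>: "\<phi> xbar \<le> \<phi> y + ereal (d \<bullet> (y - xbar) + (norm (y - xbar))\<^sup>2 / (2 * \<gamma>low))" for y
    by (rule prox_gradient_limit[OF assms(4,6) G assms(20) p g step assms(23)])
  obtain L \<delta> where L: "0 \<le> L" "0 < \<delta>" "ball xbar \<delta> \<subseteq> effdom F"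
    "\<forall>y\<in>ball xbar \<delta>. real_of_ereal (F xbar) + d \<bullet> (y - xbar) - L * (norm (y - xbar))\<^sup>2
       \<le> real_of_ereal (F y)"
    using grad_proximal_lower_bound[OF assms(12) lip] unfolding d_def by blast
  \<comment> \<open>Chosen so that \<open>1 / (2 * \<eta>)\<close> is the sum of the quadratic
    coefficients from the bounds for \<open>F\<close> and for \<phi>.\<close>
  define \<eta> where "\<eta> = 1 / (2 * (L + 1 / (2 * \<gamma>low)))"
  have "0 < L + 1 / (2 * \<gamma>low)" using L(1) assms(23) by (simp add: add_nonneg_pos)
  then have \<eta>: "0 < \<eta>" "1 / (2 * \<eta>) = L + 1 / (2 * \<gamma>low)" by (simp_all add: \<eta>_def)
  obtain P where P: "\<phi> xbar = ereal P" using ext_valued_cases[OF assms(4,21)] .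
  have "xbar \<in> effdom F" using int interior_subset by blast
  then obtain A where A: "F xbar = ereal A" using ext_valued_cases[OF assms(1)] by blast
  have "F xbar + \<phi> xbar + ereal (0 \<bullet> (y - xbar) - 1 / (2 * \<eta>) * (norm (y - xbar))\<^sup>2)
      \<le> F y + \<phi> y" if y: "y \<in> ball xbar \<delta>" for y
  proof (cases "\<phi> y = \<infinity>")
    case True
    then show ?thesis using assms(1) by (simp add: ext_valued_def)
  next
    case False
    then obtain Y where Y: "\<phi> y = ereal Y"
      using assms(4) unfolding ext_valued_def by (cases "\<phi> y") auto
    \<comment> \<open>The ball lies in \<open>effdom F\<close>, so
      \<open>real_of_ereal (F y)\<close> is the true value of \<open>F\<close> and not the default
      0.\<close>
    obtain B where B: "F y = ereal B" using ext_valued_cases[OF assms(1)] L(3) y by blast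
    have "A + d \<bullet> (y - xbar) - L * (norm (y - xbar))\<^sup>2 \<le> B" using bspec[OF L(4) y] by (simp add: A B)
    moreover have "P \<le> Y + (d \<bullet> (y - xbar) + (norm (y - xbar))\<^sup>2 / (2 * \<gamma>low))"
      using \<phi>[of y] by (simp add: P Y)
    \<comment> \<open>The linear terms in \<open>d\<close> cancel: \<phi> contributes the
      subgradient \<open>- d\<close> and \<open>F\<close> contributes \<open>d\<close>.\<close>
    ultimately have "A + P - (L + 1 / (2 * \<gamma>low)) * (norm (y - xbar))\<^sup>2 \<le> B + Y"
      by (simp add: distrib_right)
    then show ?thesis unfolding \<eta>(2) by (simp add: A B P Y)
  qed
  then have "0 \<in> proximal_subdifferential (\<lambda>u. F u + \<phi> u) xbar"
    unfolding proximal_subdifferential_def mem_Collect_eq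
    using \<eta>(1) L(2) A P by (intro conjI exI[of _ \<eta>] exI[of _ \<delta>] ballI) (simp_all add: effdom_def)
  then show ?thesis using assms(21) unfolding proximal_stationary_def by blast
qed

end
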